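(* Let $H$ be an infinite-dimensional separable complex Hilbert space and let $\mathcal T=(T_1,\dots,T_n)\in B(H)^n$. Then $$\overline{\operatorname{conv}}\,W(\mathcal T)=\operatorname{conv}\bigl(W(\mathcal T)\cup W_e(\mathcal T)\bigr).$$
   Context: $B(H)$ is the algebra of bounded linear operators on $H$; the operators $T_j$ are not assumed to commute. $\operatorname{conv}$ denotes the convex hull and $\overline{\operatorname{conv}}$ the closed convex hull in $\mathbb C^n$. Joint numerical range: $W(\mathcal T)=\{(\langle T_1x,x\rangle,\dots,\langle T_nx,x\rangle): x\in H,\ \|x\|=1\}$. Joint essential numerical range: $W_e(\mathcal T)$ is the set of all $(\lambda_1,\dots,\lambda_n)\in\mathbb C^n$ for which there exists an orthonormal sequence $(x_k)_{k\ge1}\subset H$ with $\lim_{k\to\infty}\langle T_jx_k,x_k\rangle=\lambda_j$ for $j=1,\dots,n$. *)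

theory Defs
  imports "HOL-Analysis.Analysis"
begin

(* Complex inner product spaces, built on the library's real_inner so that norm, topology and
   convexity are the library's.  The inner product is linear in the first argument.  The axioms
   scaleR_scaleC and inner_eq_Re_cinner say that the underlying real structure is the one induced
   by the complex structure; in particular norm x = sqrt (Re (cinner x x)). *)
class complex_inner = real_inner +
  fixes scaleC :: "complex \<Rightarrow> 'a \<Rightarrow> 'a" (infixr \<open>*\<^sub>C\<close> 75)
    and cinner :: "'a \<Rightarrow> 'a \<Rightarrow> complex"
  assumes scaleC_add_right: "a *\<^sub>C (x + y) = a *\<^sub>C x + a *\<^sub>C y"
    and scaleC_add_left: "(a + b) *\<^sub>C x = a *\<^sub>C x + b *\<^sub>C x"
    and scaleC_scaleC: "a *\<^sub>C (b *\<^sub>C x) = (a * b) *\<^sub>C x"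
    and scaleC_one: "1 *\<^sub>C x = x"
    and scaleR_scaleC: "scaleR r x = complex_of_real r *\<^sub>C x"
    and cinner_commute: "cinner x y = cnj (cinner y x)"
    and cinner_add_left: "cinner (x + y) z = cinner x z + cinner y z"
    and cinner_scaleC_left: "cinner (a *\<^sub>C x) y = a * cinner x y"
    and inner_eq_Re_cinner: "inner x y = Re (cinner x y)"

class complex_hilbert_space = complex_inner + complete_space

global_interpretation complex_vector: vector_space "scaleC :: complex \<Rightarrow> 'a \<Rightarrow> 'a::complex_inner"
  by unfold_locales (simp_all add: scaleC_add_right scaleC_add_left scaleC_scaleC scaleC_one)

definition complex_infinite_dimensional :: "'a::complex_inner itself \<Rightarrow> bool" where
  "complex_infinite_dimensional _ \<longleftrightarrow>
     \<not> (\<exists>B :: 'a set. finite B \<and> complex_vector.span B = UNIV)"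

definition bounded_clinear :: "('a::complex_inner \<Rightarrow> 'b::complex_inner) \<Rightarrow> bool" where
  "bounded_clinear T \<longleftrightarrow> bounded_linear T \<and> (\<forall>c x. T (c *\<^sub>C x) = c *\<^sub>C T x)"

definition orthonormal_seq :: "(nat \<Rightarrow> 'a::complex_inner) \<Rightarrow> bool" where
  "orthonormal_seq x \<longleftrightarrow> (\<forall>i j. cinner (x i) (x j) = (if i = j then 1 else 0))"

definition joint_numerical_range ::
    "('n::finite \<Rightarrow> 'a::complex_inner \<Rightarrow> 'a) \<Rightarrow> (complex ^ 'n) set" where
  "joint_numerical_range T = {(\<chi> j. cinner (T j x) x) | x. norm x = 1}"

definition joint_essential_numerical_range ::
    "('n::finite \<Rightarrow> 'a::complex_inner \<Rightarrow> 'a) \<Rightarrow> (complex ^ 'n) set" where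
  "joint_essential_numerical_range T =
     {l. \<exists>x. orthonormal_seq x \<and> (\<forall>j. (\<lambda>k. cinner (T j (x k)) (x k)) \<longlonglongrightarrow> l $ j)}"

end

theory Submission
  imports Defs "HOL-Complex_Analysis.Great_Picard"
begin

text \<open>
  Write \<open>W\<close> and \<open>W\<^sub>e\<close> for the numerical range and the essential numerical range.  Since \<open>W\<close> is a
  bounded subset of a finite-dimensional space, the convex hull of its closure is compact, so the
  closed convex hull of \<open>W\<close> is the convex hull of the closure of \<open>W\<close>.  It is therefore enough to
  relate \<open>W\<^sub>e\<close> to the closure of \<open>W\<close>.  That \<open>W\<^sub>e\<close> lies in this closure is immediate, because the
  members of an orthonormal sequence are unit vectors.

  For the converse, \<open>closure_joint_numerical_range_subset\<close>, let \<open>l\<close> be the limit of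
  \<open>\<langle>T\<^sub>j x\<^sub>k, x\<^sub>k\<rangle>\<close> for unit vectors \<open>x\<^sub>k\<close>.  By weak sequential compactness of balls
  (\<open>bounded_imp_weakly_convergent_subsequence\<close>) we may assume that \<open>x\<^sub>k\<close> converges weakly to some
  \<open>x\<close>; put \<open>u\<^sub>k = x\<^sub>k - x\<close>.  The mixed terms tend to zero, so that
  \<open>\<langle>T\<^sub>j u\<^sub>k, u\<^sub>k\<rangle>\<close> tends to \<open>l\<^sub>j - \<langle>T\<^sub>j x, x\<rangle>\<close> and the squared norm of \<open>u\<^sub>k\<close> tends to
  \<open>1 - \<parallel>x\<parallel>\<^sup>2\<close>.  After normalisation this exhibits \<open>l\<close> as a convex combination, with weights
  \<open>\<parallel>x\<parallel>\<^sup>2\<close> and \<open>1 - \<parallel>x\<parallel>\<^sup>2\<close>, of a point of \<open>W\<close> and of the limit of the values of the quadratic forms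
  along a weakly null sequence of asymptotically unit vectors; a part of weight zero is absent.
  Such a limit belongs to \<open>W\<^sub>e\<close> (\<open>weakly_null_imp_joint_essential_numerical_range\<close>): a weakly
  null sequence is asymptotically orthogonal to any finite set of vectors, so Gram-Schmidt
  corrections of arbitrarily small size extract an orthonormal sequence from it.
\<close>

section \<open>Complex inner products in terms of the real one\<close>

lemma cinner_scaleC_right: "cinner x (a *\<^sub>C y) = cnj a * cinner x y"
  by (metis cinner_commute cinner_scaleC_left complex_cnj_mult)

lemma cinner_add_right: "cinner x (y + z) = cinner x y + cinner x z"
  by (metis cinner_add_left cinner_commute complex_cnj_add)

text \<open>
  The complex inner product is determined by the real one; this is what lets weak convergence be
  formulated and used with real-valued functionals only.
\<close>

lemma cinner_eq_Complex: "cinner x y = Complex (inner x y) (inner x (\<i> *\<^sub>C y))"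
  by (simp add: complex_eq_iff inner_eq_Re_cinner cinner_scaleC_right)

lemma cinner_self: "cinner x x = complex_of_real ((norm x)\<^sup>2)"
proof -
  have "Im (cinner x x) = 0"
    using cinner_commute[of x x] by (metis cnj.sel(2) equal_neg_zero)
  then show ?thesis
    by (simp add: complex_eq_iff power2_norm_eq_inner inner_eq_Re_cinner)
qed

lemma norm_scaleC: "norm (a *\<^sub>C x) = cmod a * norm x"
proof -
  have "cinner (a *\<^sub>C x) (a *\<^sub>C x) = (a * cnj a) * cinner x x"
    by (simp add: cinner_scaleC_right cinner_scaleC_left)
  also have "\<dots> = complex_of_real ((cmod a * norm x)\<^sup>2)"
    by (simp only: cinner_self complex_norm_square[symmetric] power_mult_distrib of_real_mult)
  finally have "(norm (a *\<^sub>C x))\<^sup>2 = (cmod a * norm x)\<^sup>2"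
    by (simp only: cinner_self of_real_eq_iff)
  then show ?thesis by simp
qed

text \<open>
  Multiplying \<open>x\<close> by a scalar of modulus at most one makes the complex inner product real and
  nonnegative, which reduces the claim to the real Cauchy-Schwarz inequality.
\<close>

lemma norm_cinner_le: "norm (cinner x y) \<le> norm x * norm y"
proof -
  define a where "a = cnj (sgn (cinner x y))"
  have "a * cinner x y = complex_of_real (norm (cinner x y))"
  proof (cases "cinner x y = 0")
    case False
    have "a * cinner x y = (cinner x y * cnj (cinner x y)) / complex_of_real (norm (cinner x y))"
      by (simp add: a_def sgn_eq)
    also have "\<dots> = complex_of_real (norm (cinner x y))"
      using False by (simp add: complex_norm_square[symmetric] power2_eq_square del: of_real_power)
    finally show ?thesis .
  qed simp
  then have "norm (cinner x y) = inner (a *\<^sub>C x) y"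
    by (simp add: inner_eq_Re_cinner cinner_scaleC_left)
  also have "\<dots> \<le> norm (a *\<^sub>C x) * norm y"
    by (rule norm_cauchy_schwarz)
  also have "\<dots> \<le> norm x * norm y"
    by (intro mult_right_mono) (auto simp: norm_scaleC a_def norm_sgn)
  finally show ?thesis .
qed

lemma bounded_bilinear_cinner: "bounded_bilinear (cinner :: 'a::complex_inner \<Rightarrow> 'a \<Rightarrow> complex)"
proof
  show "\<exists>K. \<forall>x y :: 'a. norm (cinner x y) \<le> norm x * norm y * K"
    by (intro exI[of _ 1]) (simp add: norm_cinner_le)
qed (simp_all add: cinner_add_left cinner_add_right scaleR_scaleC cinner_scaleC_left
       cinner_scaleC_right scaleR_conv_of_real)

lemmas tendsto_cinner = bounded_bilinear.tendsto[OF bounded_bilinear_cinner]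
lemmas cinner_diff_left = bounded_bilinear.diff_left[OF bounded_bilinear_cinner]
lemmas cinner_diff_right = bounded_bilinear.diff_right[OF bounded_bilinear_cinner]
lemmas cinner_zero_left = bounded_bilinear.zero_left[OF bounded_bilinear_cinner]
lemmas cinner_sum_left = bounded_bilinear.sum_left[OF bounded_bilinear_cinner]
lemmas cinner_scaleR_left = bounded_bilinear.scaleR_left[OF bounded_bilinear_cinner]
lemmas cinner_scaleR_right = bounded_bilinear.scaleR_right[OF bounded_bilinear_cinner]

section \<open>Weak convergence\<close>

definition weakly_convergent_to :: "(nat \<Rightarrow> 'a::real_inner) \<Rightarrow> 'a \<Rightarrow> bool" where
  "weakly_convergent_to X x \<longleftrightarrow> (\<forall>y. (\<lambda>k. inner (X k) y) \<longlonglongrightarrow> inner x y)"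

text \<open>
  The representing vector is the minimiser of the energy \<open>\<parallel>x\<parallel>\<^sup>2 - 2 f x\<close>.  By the parallelogram
  identity every minimising sequence is Cauchy, and the first-order condition at the minimum is the
  asserted equation.
\<close>

theorem riesz_representation:
  fixes f :: "'a::{real_inner,complete_space} \<Rightarrow> real"
  assumes "bounded_linear f"
  obtains z where "\<And>y. f y = inner z y"
proof -
  interpret f: bounded_linear f by fact
  obtain K where K: "\<And>x. norm (f x) \<le> norm x * K"
    using f.bounded by blast
  define \<phi> where "\<phi> x = (norm x)\<^sup>2 - 2 * f x" for x
  have "- K\<^sup>2 \<le> \<phi> x" for x
  proof -
    have "0 \<le> (norm x - K)\<^sup>2" by simp
    then show ?thesis
      using K[of x] by (simp add: \<phi>_def power2_diff)
  qed
  then have bdd: "bdd_below (range \<phi>)"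
    by (intro bdd_belowI2)
  define m where "m = Inf (range \<phi>)"
  have m_le: "m \<le> \<phi> x" for x
    unfolding m_def by (intro cInf_lower bdd) auto
  have "\<exists>x. \<phi> x < m + inverse (real (Suc n))" for n
    using cInf_lessD[of "range \<phi>" "m + inverse (real (Suc n))"] by (auto simp: m_def)
  then obtain X where X: "\<And>n. \<phi> (X n) < m + inverse (real (Suc n))"
    by metis
  have par: "(norm (x - y))\<^sup>2 \<le> 2 * (\<phi> x - m) + 2 * (\<phi> y - m)" for x y
  proof -
    have "4 * \<phi> ((1/2) *\<^sub>R (x + y)) = 2 * \<phi> x + 2 * \<phi> y - (norm (x - y))\<^sup>2"
      by (simp add: \<phi>_def power2_norm_eq_inner inner_simps f.add f.scaleR inner_commute algebra_simps)
    moreover have "m \<le> \<phi> ((1/2) *\<^sub>R (x + y))" by (rule m_le)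
    ultimately show ?thesis by argo
  qed
  have "Cauchy X"
  proof (rule metric_CauchyI)
    fix e :: real assume "0 < e"
    then obtain N where N: "inverse (Suc N) < e\<^sup>2 / 4"
      using reals_Archimedean[of "e\<^sup>2 / 4"] by auto
    show "\<exists>M. \<forall>m\<ge>M. \<forall>n\<ge>M. dist (X m) (X n) < e"
    proof (intro exI allI impI)
      fix i j assume "N \<le> i" "N \<le> j"
      then have "inverse (real (Suc i)) \<le> inverse (Suc N)" "inverse (real (Suc j)) \<le> inverse (Suc N)"
        by (auto intro!: le_imp_inverse_le)
      then have "(norm (X i - X j))\<^sup>2 < e\<^sup>2"
        using par[of "X i" "X j"] X[of i] X[of j] N by argo
      then show "dist (X i) (X j) < e"
        using \<open>0 < e\<close> by (simp add: dist_norm power_less_imp_less_base)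
    qed
  qed
  then obtain z where z: "X \<longlonglongrightarrow> z"
    using Cauchy_convergent_iff convergent_def by blast
  have "(\<lambda>n. \<phi> (X n)) \<longlonglongrightarrow> \<phi> z"
    unfolding \<phi>_def by (intro tendsto_intros f.tendsto z)
  moreover have "(\<lambda>n. m + inverse (real (Suc n))) \<longlonglongrightarrow> m + 0"
    by (intro tendsto_intros LIMSEQ_inverse_real_of_nat)
  ultimately have "\<phi> z \<le> m + 0"
    by (rule LIMSEQ_le) (use X less_imp_le in blast)
  then have min: "\<phi> z \<le> \<phi> x" for x
    using m_le[of x] by simp
  have "f y = inner z y" for y
  proof -
    define c where "c = inner z y - f y"
    define N where "N = (norm y)\<^sup>2"
    define t where "t = c / (N + 1)"
    have N: "0 \<le> N" by (simp add: N_def)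
    have "\<phi> (z - t *\<^sub>R y) = \<phi> z - 2 * t * c + t * t * N"
      by (simp add: \<phi>_def c_def N_def power2_norm_eq_inner inner_simps f.diff f.scaleR inner_commute
            algebra_simps)
    then have "2 * t * c \<le> t\<^sup>2 * N"
      using min[of "z - t *\<^sub>R y"] by (simp add: power2_eq_square)
    moreover have "c = t * (N + 1)" using N by (simp add: t_def)
    ultimately have "2 * t * (t * (N + 1)) \<le> t\<^sup>2 * N" by simp
    then have "t\<^sup>2 * (N + 2) \<le> 0" by (simp add: algebra_simps power2_eq_square)
    then have "t = 0" using N by (simp add: mult_le_0_iff)
    with \<open>c = t * (N + 1)\<close> show ?thesis by (simp add: c_def)
  qed
  then show thesis by (rule that)
qed

lemma weakly_convergent_to_bounded_linear:
  fixes X :: "nat \<Rightarrow> 'a::{real_inner,complete_space}" and f :: "'a \<Rightarrow> real"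
  assumes "weakly_convergent_to X x" "bounded_linear f"
  shows "(\<lambda>k. f (X k)) \<longlonglongrightarrow> f x"
proof -
  obtain z where "\<And>y. f y = inner z y"
    using riesz_representation[OF assms(2)] by blast
  then show ?thesis
    using assms(1) by (simp add: weakly_convergent_to_def inner_commute[of z])
qed

text \<open>
  A diagonal subsequence makes the inner products with the members of a countable dense set
  converge.  Boundedness extends the convergence to all vectors, and the limit is a bounded
  functional, hence given by a vector.
\<close>

theorem bounded_imp_weakly_convergent_subsequence:
  fixes X :: "nat \<Rightarrow> 'a::{real_inner,complete_space}"
  assumes sep: "separable_space (euclidean :: 'a topology)"
    and M: "\<And>n. norm (X n) \<le> M"
  obtains r x where "strict_mono r" "weakly_convergent_to (X \<circ> r) x"
proof -
  obtain D :: "'a set" where D: "countable D" "closure D = UNIV"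
    using sep by (auto simp: separable_space_def)
  have M0: "0 \<le> M" using M[of 0] norm_ge_zero order_trans by blast
  \<comment> \<open>Normalising the dense vectors gives one bound for all of them, as the diagonal argument
    requires.\<close>
  have "norm (inner (X n) (sgn d)) \<le> M" for n d
  proof -
    have "norm (inner (X n) (sgn d)) \<le> norm (X n) * norm (sgn d)"
      using Cauchy_Schwarz_ineq2 by simp
    also have "\<dots> \<le> M * 1"
      by (intro mult_mono M M0) (auto simp: norm_sgn)
    finally show ?thesis by simp
  qed
  then obtain r where r: "strict_mono r"
    and conv: "\<And>d. d \<in> D \<Longrightarrow> \<exists>l. (\<lambda>n. inner (X (r n)) (sgn d)) \<longlonglongrightarrow> l"
    using function_convergent_subsequence[OF D(1), of "\<lambda>n d. inner (X n) (sgn d)" M] by metis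
  define Y where "Y = X \<circ> r"
  have Y: "norm (Y n) \<le> M" for n by (simp add: Y_def M)
  have conv_D: "Cauchy (\<lambda>n. inner (Y n) d)" if d: "d \<in> D" for d
  proof -
    obtain l where l: "(\<lambda>n. inner (X (r n)) (sgn d)) \<longlonglongrightarrow> l" using conv[OF d] by blast
    have "(\<lambda>n. norm d * inner (X (r n)) (sgn d)) \<longlonglongrightarrow> norm d * l"
      by (intro tendsto_intros l)
    moreover have "norm d * inner (X (r n)) (sgn d) = inner (Y n) d" for n
      by (cases "d = 0") (simp_all add: Y_def sgn_div_norm)
    ultimately show ?thesis
      using LIMSEQ_imp_Cauchy by simp
  qed
  have "\<exists>l. (\<lambda>n. inner (Y n) y) \<longlonglongrightarrow> l" for y
  proof -
    have "Cauchy (\<lambda>n. inner (Y n) y)"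
    proof (rule metric_CauchyI)
      fix e :: real assume e: "0 < e"
      \<comment> \<open>The denominator uses \<open>M + 1\<close> because \<open>M\<close> may be zero.\<close>
      define \<delta> where "\<delta> = e / (4 * (M + 1))"
      have \<delta>: "0 < \<delta>" using e M0 by (simp add: \<delta>_def)
      have "y \<in> closure D" using D by simp
      then obtain d where d: "d \<in> D" "dist d y < \<delta>"
        using \<delta> closure_approachable by blast
      have small: "\<bar>inner (Y n) (y - d)\<bar> \<le> e / 4" for n
      proof -
        have "\<bar>inner (Y n) (y - d)\<bar> \<le> norm (Y n) * norm (y - d)"
          by (rule Cauchy_Schwarz_ineq2)
        also have "\<dots> \<le> (M + 1) * \<delta>"
          using d(2) Y[of n] M0 by (intro mult_mono) (auto simp: dist_norm norm_minus_commute)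
        also have "\<dots> = e / 4" using M0 by (simp add: \<delta>_def divide_simps)
        finally show ?thesis .
      qed
      obtain N where N: "\<And>m n. m \<ge> N \<Longrightarrow> n \<ge> N \<Longrightarrow> dist (inner (Y m) d) (inner (Y n) d) < e / 2"
        using metric_CauchyD[OF conv_D[OF d(1)], of "e / 2"] e by auto
      show "\<exists>N. \<forall>m\<ge>N. \<forall>n\<ge>N. dist (inner (Y m) y) (inner (Y n) y) < e"
      proof (intro exI allI impI)
        fix m n assume "N \<le> m" "N \<le> n"
        then show "dist (inner (Y m) y) (inner (Y n) y) < e"
          using N[of m n] small[of m] small[of n]
          unfolding dist_real_def inner_diff_right abs_le_iff abs_less_iff by linarith
      qed
    qed
    then show ?thesis by (simp add: Cauchy_convergent_iff convergent_def)
  qed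
  then obtain f where f: "\<And>y. (\<lambda>n. inner (Y n) y) \<longlonglongrightarrow> f y" by metis
  have "bounded_linear f"
  proof (rule bounded_linear_intro)
    fix x y
    have "(\<lambda>n. inner (Y n) (x + y)) \<longlonglongrightarrow> f x + f y"
      unfolding inner_add_right by (intro tendsto_intros f)
    then show "f (x + y) = f x + f y" using f LIMSEQ_unique by blast
  next
    fix a x
    have "(\<lambda>n. inner (Y n) (a *\<^sub>R x)) \<longlonglongrightarrow> a *\<^sub>R f x"
      unfolding inner_scaleR_right real_scaleR_def by (intro tendsto_intros f)
    then show "f (a *\<^sub>R x) = a *\<^sub>R f x" using f LIMSEQ_unique by blast
  next
    fix x
    have "norm (inner (Y n) x) \<le> norm x * M" for n
      using Cauchy_Schwarz_ineq2[of "Y n" x] mult_right_mono[OF Y[of n], of "norm x"]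
      by (simp add: mult.commute)
    then show "norm (f x) \<le> norm x * M"
      by (intro LIMSEQ_le_const2[OF tendsto_norm[OF f]]) auto
  qed
  then obtain x where "\<And>y. f y = inner x y"
    using riesz_representation by blast
  then have "weakly_convergent_to (X \<circ> r) x"
    using f by (simp add: weakly_convergent_to_def Y_def)
  with r show thesis by (rule that)
qed

lemma weakly_convergent_to_cinner:
  fixes X :: "nat \<Rightarrow> 'a::complex_hilbert_space"
  assumes X: "weakly_convergent_to X x" and T: "bounded_linear T"
  shows "(\<lambda>k. cinner (T (X k)) y) \<longlonglongrightarrow> cinner (T x) y"
proof -
  have "(\<lambda>k. inner (T (X k)) z) \<longlonglongrightarrow> inner (T x) z" for z
    using weakly_convergent_to_bounded_linear[OF X bounded_linear_compose[OF bounded_linear_inner_left T]] .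
  then show ?thesis
    by (simp only: cinner_eq_Complex tendsto_Complex)
qed

section \<open>Weakly null sequences and the essential numerical range\<close>

text \<open>
  This is the Gram-Schmidt step that continues an orthonormal family.  Far out in a weakly null
  sequence the projection \<open>p k\<close> of \<open>u k\<close> to the span of the family is small in norm, so that
  subtracting it and normalising changes neither the norm nor the quadratic forms in the limit.
\<close>

lemma approximate_orthogonal_unit_vector:
  fixes T :: "'n::finite \<Rightarrow> 'a::complex_hilbert_space \<Rightarrow> 'a" and f :: "nat \<Rightarrow> 'a"
  assumes T: "\<And>j. bounded_linear (T j)"
    and u: "weakly_convergent_to u 0" "(\<lambda>k. norm (u k)) \<longlonglongrightarrow> 1"
    and lim: "\<And>j. (\<lambda>k. cinner (T j (u k)) (u k)) \<longlonglongrightarrow> l j"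
    and f: "\<And>i j. i < n \<Longrightarrow> j < n \<Longrightarrow> cinner (f i) (f j) = (if i = j then 1 else 0)"
    and e: "0 < e"
  obtains v where "norm v = 1" "\<And>i. i < n \<Longrightarrow> cinner v (f i) = 0"
    "\<And>j. dist (cinner (T j v) v) (l j) < e"
proof -
  define p where "p k = (\<Sum>i<n. cinner (u k) (f i) *\<^sub>C f i)" for k
  define w where "w k = u k - p k" for k
  have p_f: "cinner (p k) (f i) = cinner (u k) (f i)" if "i < n" for k i
  proof -
    have "cinner (p k) (f i) = (\<Sum>j<n. if j = i then cinner (u k) (f j) else 0)"
      unfolding p_def cinner_sum_left using that f
      by (intro sum.cong) (auto simp: cinner_scaleC_left)
    also have "\<dots> = cinner (u k) (f i)"
      using that by (subst sum.delta) auto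
    finally show ?thesis .
  qed
  have orth: "cinner (w k) (f i) = 0" if "i < n" for k i
    using p_f[OF that] by (simp add: w_def cinner_diff_left)
  have "(\<lambda>k. cinner (u k) (f i)) \<longlonglongrightarrow> 0" for i
    using weakly_convergent_to_cinner[OF u(1) bounded_linear_ident, of "f i"]
    by (simp only: cinner_zero_left)
  then have "(\<lambda>k. \<Sum>i<n. norm (cinner (u k) (f i)) * norm (f i)) \<longlonglongrightarrow> (\<Sum>i<n. norm (0::complex) * norm (f i))"
    by (intro tendsto_intros)
  then have "(\<lambda>k. \<Sum>i<n. norm (cinner (u k) (f i)) * norm (f i)) \<longlonglongrightarrow> 0"
    by simp
  moreover have "norm (p k) \<le> (\<Sum>i<n. norm (cinner (u k) (f i)) * norm (f i))" for k
    unfolding p_def norm_scaleC[symmetric] by (rule norm_sum)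
  ultimately have p0: "p \<longlonglongrightarrow> 0"
    by (intro Lim_null_comparison[OF always_eventually[OF allI], of p])
  have w_norm: "(\<lambda>k. norm (w k)) \<longlonglongrightarrow> 1"
  proof -
    have "norm (norm (w k) - norm (u k)) \<le> norm (p k)" for k
      using norm_triangle_ineq3[of "w k" "u k"] by (simp add: w_def)
    then have "(\<lambda>k. norm (w k) - norm (u k)) \<longlonglongrightarrow> 0"
      using tendsto_norm_zero[OF p0] by (rule Lim_null_comparison[OF always_eventually[OF allI]])
    from tendsto_add[OF this u(2)] show ?thesis by simp
  qed
  have w_lim: "(\<lambda>k. cinner (T j (w k)) (w k)) \<longlonglongrightarrow> l j" for j
  proof -
    interpret T: bounded_linear "T j" by (rule T)
    obtain K where K: "\<And>x. norm (T j x) \<le> norm x * K" using T.bounded by blast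
    have "norm (cinner (T j (p k)) (w k)) \<le> norm (p k) * K * norm (w k)" for k
      using norm_cinner_le[of "T j (p k)" "w k"] mult_right_mono[OF K[of "p k"], of "norm (w k)"]
      by simp
    moreover have "(\<lambda>k. norm (p k) * K * norm (w k)) \<longlonglongrightarrow> 0"
      using tendsto_mult[OF tendsto_mult_left_zero[OF tendsto_norm_zero[OF p0]] w_norm] by simp
    ultimately have 1: "(\<lambda>k. cinner (T j (p k)) (w k)) \<longlonglongrightarrow> 0"
      by (rule Lim_null_comparison[OF always_eventually[OF allI]])
    have "norm (cinner (T j (u k)) (p k)) \<le> norm (u k) * K * norm (p k)" for k
      using norm_cinner_le[of "T j (u k)" "p k"] mult_right_mono[OF K[of "u k"], of "norm (p k)"]
      by simp
    moreover have "(\<lambda>k. norm (u k) * K * norm (p k)) \<longlonglongrightarrow> 0"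
      using tendsto_mult[OF tendsto_mult_right[OF u(2)] tendsto_norm_zero[OF p0]] by simp
    ultimately have 2: "(\<lambda>k. cinner (T j (u k)) (p k)) \<longlonglongrightarrow> 0"
      by (rule Lim_null_comparison[OF always_eventually[OF allI]])
    have "cinner (T j (w k)) (w k)
        = cinner (T j (u k)) (u k) - cinner (T j (u k)) (p k) - cinner (T j (p k)) (w k)" for k
      by (simp add: w_def T.diff cinner_diff_left cinner_diff_right)
    then show ?thesis
      using tendsto_diff[OF tendsto_diff[OF lim[of j] 2] 1] by simp
  qed
  have "(\<lambda>k. cinner (T j (sgn (w k))) (sgn (w k))) \<longlonglongrightarrow> l j" for j
  proof -
    interpret T: bounded_linear "T j" by (rule T)
    have "cinner (T j (sgn (w k))) (sgn (w k))
        = inverse (norm (w k)) *\<^sub>R inverse (norm (w k)) *\<^sub>R cinner (T j (w k)) (w k)" for k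
      by (simp add: sgn_div_norm T.scaleR cinner_scaleR_left cinner_scaleR_right)
    moreover have "(\<lambda>k. inverse (norm (w k)) *\<^sub>R inverse (norm (w k)) *\<^sub>R cinner (T j (w k)) (w k))
        \<longlonglongrightarrow> inverse 1 *\<^sub>R inverse 1 *\<^sub>R l j"
      by (intro tendsto_intros w_norm w_lim) auto
    ultimately show ?thesis by simp
  qed
  then have "\<forall>\<^sub>F k in sequentially. \<forall>j\<in>UNIV. dist (cinner (T j (sgn (w k))) (sgn (w k))) (l j) < e"
    by (intro eventually_ball_finite) (auto intro: tendstoD e)
  moreover have "\<forall>\<^sub>F k in sequentially. norm (w k) > 0"
    using w_norm by (rule order_tendstoD) simp
  ultimately have "\<forall>\<^sub>F k in sequentially. w k \<noteq> 0 \<and>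
      (\<forall>j. dist (cinner (T j (sgn (w k))) (sgn (w k))) (l j) < e)"
    by eventually_elim auto
  then obtain k where k: "w k \<noteq> 0" "\<And>j. dist (cinner (T j (sgn (w k))) (sgn (w k))) (l j) < e"
    using eventually_happens' sequentially_bot by blast
  show thesis
  proof (rule that)
    show "norm (sgn (w k)) = 1" using k(1) by (simp add: norm_sgn)
    show "cinner (sgn (w k)) (f i) = 0" if "i < n" for i
      using orth[OF that] by (simp add: sgn_div_norm cinner_scaleR_left)
  qed (rule k(2))
qed

text \<open>
  The members of the orthonormal sequence are chosen one after the other, the \<open>n\<close>-th one orthogonal
  to its predecessors and with tolerance \<open>1 / (n + 1)\<close> for the values of the quadratic forms; only
  finitely many orthogonality conditions arise at each stage.
\<close>

lemma weakly_null_imp_joint_essential_numerical_range: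
  fixes T :: "'n::finite \<Rightarrow> 'a::complex_hilbert_space \<Rightarrow> 'a"
  assumes T: "\<And>j. bounded_linear (T j)"
    and u: "weakly_convergent_to u 0" "(\<lambda>k. norm (u k)) \<longlonglongrightarrow> 1"
    and lim: "\<And>j. (\<lambda>k. cinner (T j (u k)) (u k)) \<longlonglongrightarrow> l $ j"
  shows "l \<in> joint_essential_numerical_range T"
proof -
  \<comment> \<open>\<open>P f n v\<close> says that \<open>v\<close> is an admissible \<open>n\<close>-th member when the earlier ones are
    \<open>f 0, ..., f (n - 1)\<close>.\<close>
  define P where "P f n v \<longleftrightarrow> norm v = 1 \<and> (\<forall>i<n. cinner v (f i) = 0) \<and>
      (\<forall>j. dist (cinner (T j v) v) (l $ j) < inverse (real (Suc n)))" for f n v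
  have ortho: "cinner (f i) (f j) = (if i = j then 1 else 0)"
    if P: "\<And>k. k < n \<Longrightarrow> P f k (f k)" and "i < n" "j < n" for f n i j
  proof (cases i j rule: linorder_cases)
    case less
    then have "cinner (f j) (f i) = 0" using P[OF \<open>j < n\<close>] by (simp add: P_def)
    then show ?thesis using less cinner_commute[of "f i" "f j"] by simp
  next
    case equal
    then show ?thesis using P[OF \<open>i < n\<close>] by (simp add: P_def cinner_self)
  next
    case greater
    then show ?thesis using P[OF \<open>i < n\<close>] by (simp add: P_def)
  qed
  have "\<exists>f. \<forall>n. P f n (f n)"
  proof (rule dependent_wellorder_choice)
    show "P f n v = P g n v" if "\<And>y. y < n \<Longrightarrow> f y = g y" for v f g n
      using that by (simp add: P_def)
    show "\<exists>v. P f n v" if "\<And>y. y < n \<Longrightarrow> P f y (f y)" for f n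
    proof -
      have "cinner (f i) (f j) = (if i = j then 1 else 0)" if "i < n" "j < n" for i j
        using ortho[OF \<open>\<And>y. y < n \<Longrightarrow> P f y (f y)\<close>] that by blast
      moreover have "0 < inverse (real (Suc n))" by simp
      ultimately show ?thesis
      proof (rule approximate_orthogonal_unit_vector[of T u "\<lambda>j. l $ j" n f, OF T u lim])
        fix v
        assume "norm v = 1" "\<And>i. i < n \<Longrightarrow> cinner v (f i) = 0"
          "\<And>j. dist (cinner (T j v) v) (l $ j) < inverse (real (Suc n))"
        then have "P f n v" by (simp add: P_def)
        then show ?thesis ..
      qed
    qed
  qed
  then obtain f where f: "\<And>n. P f n (f n)" by blast
  have "orthonormal_seq f"
    unfolding orthonormal_seq_def
  proof (intro allI)
    fix i j
    show "cinner (f i) (f j) = (if i = j then 1 else 0)"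
      by (rule ortho[of "Suc (max i j)"]) (auto intro: f)
  qed
  moreover have "(\<lambda>k. cinner (T j (f k)) (f k)) \<longlonglongrightarrow> l $ j" for j
  proof (rule LIM_zero_cancel, rule Lim_null_comparison)
    show "\<forall>\<^sub>F k in sequentially. norm (cinner (T j (f k)) (f k) - l $ j) \<le> inverse (real (Suc k))"
      using f by (intro always_eventually allI less_imp_le) (auto simp: P_def dist_norm)
  qed (rule LIMSEQ_inverse_real_of_nat)
  ultimately show ?thesis
    by (auto simp: joint_essential_numerical_range_def)
qed

section \<open>Limit points of the numerical range\<close>

text \<open>
  Splitting a weakly convergent sequence of unit vectors into its weak limit \<open>x\<close> and a weakly null
  part splits the limit point accordingly: \<open>x\<close> contributes a point \<open>y\<close> of the numerical range with
  weight \<open>\<parallel>x\<parallel>\<^sup>2\<close>, and the weakly null part contributes a point \<open>m\<close> of the essential numerical range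
  with the remaining weight \<open>s\<close>.
\<close>

lemma closure_joint_numerical_range_subset:
  fixes T :: "'n::finite \<Rightarrow> 'a::complex_hilbert_space \<Rightarrow> 'a"
  assumes sep: "separable_space (euclidean :: 'a topology)"
    and T: "\<And>j. bounded_linear (T j)"
  shows "closure (joint_numerical_range T) \<subseteq>
    convex hull (joint_numerical_range T \<union> joint_essential_numerical_range T)"
    (is "_ \<subseteq> convex hull (?W \<union> ?We)")
proof
  fix l assume "l \<in> closure ?W"
  then obtain w where w: "\<And>k. w k \<in> ?W" "w \<longlonglongrightarrow> l"
    unfolding closure_sequential by blast
  then have "\<forall>k. \<exists>x. norm x = 1 \<and> w k = (\<chi> j. cinner (T j x) x)"
    by (auto simp: joint_numerical_range_def)
  then obtain X where X: "\<And>k. norm (X k) = 1" "\<And>k. w k = (\<chi> j. cinner (T j (X k)) (X k))"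
    by metis
  obtain r x where r: "strict_mono r" and Xr: "weakly_convergent_to (X \<circ> r) x"
    using bounded_imp_weakly_convergent_subsequence[OF sep, of X 1] X(1) by auto
  define Y where "Y = X \<circ> r"
  have Y: "weakly_convergent_to Y x" "\<And>k. norm (Y k) = 1"
    using Xr X(1) by (simp_all add: Y_def)
  have Y_lim: "(\<lambda>k. cinner (T j (Y k)) (Y k)) \<longlonglongrightarrow> l $ j" for j
    using tendsto_vec_nth[OF LIMSEQ_subseq_LIMSEQ[OF w(2) r], of j]
    by (simp add: X(2) Y_def o_def)
  define u where "u k = Y k - x" for k
  have u_weak: "weakly_convergent_to u 0"
    unfolding weakly_convergent_to_def u_def inner_diff_left inner_zero_left
    using Y(1) by (intro allI LIM_zero) (simp add: weakly_convergent_to_def)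
  have u_norm: "(\<lambda>k. (norm (u k))\<^sup>2) \<longlonglongrightarrow> 1 - (norm x)\<^sup>2"
  proof -
    have "(norm (u k))\<^sup>2 = 1 - (norm x)\<^sup>2 - 2 * inner (u k) x" for k
    proof -
      have "(norm (u k + x))\<^sup>2 = 1" by (simp add: u_def Y)
      then show ?thesis by (simp add: power2_norm_eq_inner inner_simps inner_commute)
    qed
    moreover have "(\<lambda>k. inner (u k) x) \<longlonglongrightarrow> 0"
      using u_weak by (simp add: weakly_convergent_to_def)
    then have "(\<lambda>k. 1 - (norm x)\<^sup>2 - 2 * inner (u k) x) \<longlonglongrightarrow> 1 - (norm x)\<^sup>2 - 2 * 0"
      by (intro tendsto_intros)
    ultimately show ?thesis by simp
  qed
  have u_lim: "(\<lambda>k. cinner (T j (u k)) (u k)) \<longlonglongrightarrow> l $ j - cinner (T j x) x" for j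
  proof -
    interpret T: bounded_linear "T j" by (rule T)
    have 1: "(\<lambda>k. cinner (T j (u k)) x) \<longlonglongrightarrow> 0"
      using weakly_convergent_to_cinner[OF u_weak T, of j x]
      by (simp only: T.zero cinner_zero_left)
    have "(\<lambda>k. cnj (cinner (u k) (T j x))) \<longlonglongrightarrow> cnj (cinner 0 (T j x))"
      by (intro tendsto_cnj weakly_convergent_to_cinner[OF u_weak bounded_linear_ident])
    then have 2: "(\<lambda>k. cinner (T j x) (u k)) \<longlonglongrightarrow> 0"
      by (simp only: cinner_commute[of "T j x"] cinner_zero_left complex_cnj_zero)
    have "cinner (T j (u k)) (u k)
        = cinner (T j (Y k)) (Y k) - cinner (T j x) x - cinner (T j (u k)) x - cinner (T j x) (u k)" for k
      by (simp add: u_def T.diff cinner_diff_left cinner_diff_right)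
    then show ?thesis
      using tendsto_diff[OF tendsto_diff[OF tendsto_diff[OF Y_lim[of j] tendsto_const] 1] 2] by simp
  qed
  define s where "s = 1 - (norm x)\<^sup>2"
  have "0 \<le> s"
    unfolding s_def by (rule LIMSEQ_le_const[OF u_norm]) simp
  \<comment> \<open>For \<open>x = 0\<close> the vector \<open>sgn x\<close> is zero, so that \<open>y\<close> need not lie in the numerical range; it
    then carries weight zero.\<close>
  define y where "y = (\<chi> j. cinner (T j (sgn x)) (sgn x))"
  have y_scale: "cinner (T j x) x = (norm x)\<^sup>2 *\<^sub>R y $ j" for j
  proof -
    interpret T: bounded_linear "T j" by (rule T)
    have "cinner (T j (norm x *\<^sub>R sgn x)) (norm x *\<^sub>R sgn x) = (norm x)\<^sup>2 *\<^sub>R y $ j"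
      by (simp only: y_def T.scaleR cinner_scaleR_left cinner_scaleR_right power2_eq_square
          scaleR_scaleR vec_lambda_beta)
    moreover have "norm x *\<^sub>R sgn x = x" by (cases "x = 0") (simp_all add: sgn_div_norm)
    ultimately show ?thesis by simp
  qed
  have y_W: "y \<in> ?W" if "x \<noteq> 0"
    using that by (auto simp: y_def joint_numerical_range_def norm_sgn)
  show "l \<in> convex hull (?W \<union> ?We)"
  \<comment> \<open>If \<open>s = 0\<close> the convergence to \<open>x\<close> is in norm and no essential part remains.\<close>
  proof (cases "s = 0")
    case True
    then have "(\<lambda>k. (norm (u k))\<^sup>2) \<longlonglongrightarrow> 0" using u_norm by (simp add: s_def)
    then have "(\<lambda>k. sqrt ((norm (u k))\<^sup>2)) \<longlonglongrightarrow> sqrt 0" by (rule tendsto_real_sqrt)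
    then have u0: "u \<longlonglongrightarrow> 0" by (simp add: tendsto_norm_zero_iff)
    have "l $ j = y $ j" for j
    proof -
      interpret T: bounded_linear "T j" by (rule T)
      have "(\<lambda>k. cinner (T j (u k)) (u k)) \<longlonglongrightarrow> cinner (T j 0) 0"
        by (intro tendsto_cinner T.tendsto u0)
      then have "l $ j - cinner (T j x) x = 0"
        using LIMSEQ_unique[OF u_lim[of j]] by (simp add: T.zero cinner_zero_left)
      then show ?thesis using y_scale[of j] True by (simp add: s_def)
    qed
    then have "l = y" by (simp add: vec_eq_iff)
    moreover have "x \<noteq> 0" using True by (auto simp: s_def)
    ultimately show ?thesis using y_W by (simp add: hull_inc)
  next
    case False
    then have s: "0 < s" using \<open>0 \<le> s\<close> by simp
    define m where "m = (1 / s) *\<^sub>R (l - (1 - s) *\<^sub>R y)"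
    define v where "v k = (1 / sqrt s) *\<^sub>R u k" for k
    have m: "m \<in> ?We"
    proof (rule weakly_null_imp_joint_essential_numerical_range[where u = v, OF T])
      show "weakly_convergent_to v 0"
        using u_weak unfolding weakly_convergent_to_def v_def inner_scaleR_left inner_zero_left
        by (intro allI tendsto_mult_right_zero) auto
      have "(\<lambda>k. 1 / sqrt s * sqrt ((norm (u k))\<^sup>2)) \<longlonglongrightarrow> 1 / sqrt s * sqrt s"
        unfolding s_def by (intro tendsto_intros u_norm)
      then show "(\<lambda>k. norm (v k)) \<longlonglongrightarrow> 1" using s by (simp add: v_def)
      show "(\<lambda>k. cinner (T j (v k)) (v k)) \<longlonglongrightarrow> m $ j" for j
      proof -
        interpret T: bounded_linear "T j" by (rule T)
        have "cinner (T j (v k)) (v k) = (1 / s) *\<^sub>R cinner (T j (u k)) (u k)" for k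
          using s by (simp add: v_def T.scaleR cinner_scaleR_left cinner_scaleR_right)
        moreover have "m $ j = (1 / s) *\<^sub>R (l $ j - cinner (T j x) x)"
          using y_scale[of j] by (simp add: m_def s_def)
        ultimately show ?thesis
          using tendsto_scaleR[OF tendsto_const u_lim[of j]] by simp
      qed
    qed
    have l: "l = (1 - s) *\<^sub>R y + s *\<^sub>R m"
      using s by (simp add: m_def)
    show ?thesis
    proof (cases "x = 0")
      case True
      then have "l = m" using l by (simp add: s_def)
      then show ?thesis using m by (simp add: hull_inc)
    next
      case False
      then have "y \<in> convex hull (?W \<union> ?We)" "m \<in> convex hull (?W \<union> ?We)"
        using y_W m by (auto intro: hull_inc)
      then show ?thesis
        unfolding l using s by (intro convexD convex_convex_hull) (auto simp: s_def)
    qed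
  qed
qed

lemma joint_essential_numerical_range_subset_closure:
  "joint_essential_numerical_range T \<subseteq> closure (joint_numerical_range T)"
proof
  fix l assume "l \<in> joint_essential_numerical_range T"
  then obtain x where x: "orthonormal_seq x" "\<And>j. (\<lambda>k. cinner (T j (x k)) (x k)) \<longlonglongrightarrow> l $ j"
    by (auto simp: joint_essential_numerical_range_def)
  have "norm (x k) = 1" for k
  proof -
    have "cinner (x k) (x k) = 1"
      using x(1) by (simp add: orthonormal_seq_def)
    then have "(norm (x k))\<^sup>2 = 1"
      by (simp only: cinner_self of_real_eq_1_iff)
    then show ?thesis
      using norm_ge_zero[of "x k"] by (simp add: power2_eq_1_iff)
  qed
  then have "\<forall>k. (\<chi> j. cinner (T j (x k)) (x k)) \<in> joint_numerical_range T"
    by (auto simp: joint_numerical_range_def)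
  moreover have "(\<lambda>k. \<chi> j. cinner (T j (x k)) (x k)) \<longlonglongrightarrow> l"
    using x(2) by (intro vec_tendstoI) simp
  ultimately show "l \<in> closure (joint_numerical_range T)"
    unfolding closure_sequential by (intro exI conjI)
qed

lemma bounded_joint_numerical_range:
  fixes T :: "'n::finite \<Rightarrow> 'a::complex_inner \<Rightarrow> 'a"
  assumes "\<And>j. bounded_linear (T j)"
  shows "bounded (joint_numerical_range T)"
proof -
  have "\<exists>K. \<forall>x. norm (T j x) \<le> norm x * K" for j
    using assms bounded_linear.bounded by blast
  then obtain K where K: "\<And>j x. norm (T j x) \<le> norm x * K j" by metis
  have "norm v \<le> (\<Sum>j\<in>UNIV. K j)" if v: "v \<in> joint_numerical_range T" for v
  proof -
    obtain x where x: "norm x = 1" "v = (\<chi> j. cinner (T j x) x)"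
      using v by (auto simp: joint_numerical_range_def)
    have "norm (v $ j) \<le> K j" for j
      using norm_cinner_le[of "T j x" x] K[of j x] x by simp
    then show ?thesis
      unfolding norm_vec_def
      by (intro order_trans[OF L2_set_le_sum] sum_mono) auto
  qed
  then show ?thesis unfolding bounded_iff by blast
qed

theorem theorem5p1:
  fixes T :: "'n::finite \<Rightarrow> 'a::complex_hilbert_space \<Rightarrow> 'a"
  assumes infinite_dim: "complex_infinite_dimensional TYPE('a)"
    and separable: "separable_space (euclidean :: 'a topology)"
    and bounded_op: "\<And>j. bounded_clinear (T j)"
  shows "closure (convex hull (joint_numerical_range T)) =
         convex hull (joint_numerical_range T \<union> joint_essential_numerical_range T)"
proof -
  let ?W = "joint_numerical_range T" and ?We = "joint_essential_numerical_range T"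
  have T: "bounded_linear (T j)" for j
    using bounded_op by (simp add: bounded_clinear_def)
  have "closure (convex hull ?W) = convex hull (closure ?W)"
  proof
    \<comment> \<open>In finite dimension convex hulls of compact sets are compact.\<close>
    have "compact (convex hull (closure ?W))"
      using bounded_joint_numerical_range[of T, OF T] by (simp add: compact_convex_hull)
    then show "closure (convex hull ?W) \<subseteq> convex hull (closure ?W)"
      by (intro closure_minimal hull_mono closure_subset compact_imp_closed)
    show "convex hull (closure ?W) \<subseteq> closure (convex hull ?W)"
      by (intro hull_minimal closure_mono hull_subset convex_closure convex_convex_hull)
  qed
  also have "\<dots> = convex hull (?W \<union> ?We)"
  proof
    show "convex hull (closure ?W) \<subseteq> convex hull (?W \<union> ?We)"
      by (intro hull_minimal closure_joint_numerical_range_subset separable T convex_convex_hull)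
    show "convex hull (?W \<union> ?We) \<subseteq> convex hull (closure ?W)"
      using closure_subset joint_essential_numerical_range_subset_closure by (intro hull_mono) blast
  qed
  finally show ?thesis .
qed

end
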